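(* Let $\mathcal{X}=\{x_k\}_{k=1}^m$ be a frame for a real or complex $n$-dimensional Hilbert space $\mathbb{H}^n$. Then the following are equivalent: (1) $\mathcal{X}$ is injective; (2) for every orthonormal basis $\mathcal{E}=\{e_j\}_{j=1}^n$ of $\mathbb{H}^n$, \[ \mathrm{span}\{(|\langle x_k,e_1\rangle|^2,|\langle x_k,e_2\rangle|^2,\dots,|\langle x_k,e_n\rangle|^2):k=1,\dots,m\}=\mathbb{R}^n.\]
   Context: A family $\{x_k\}$ of vectors in a Hilbert space is called injective if whenever a self-adjoint operator $T$ satisfies $\langle Tx_k,x_k\rangle=0$ for all $k$, then $T=0$. *)

theory Defs
  imports "HOL-Analysis.Analysis"
begin

text \<open>The Hilbert space H^n is modelled as 'F ^ 'n with 'F = real or 'F = complex,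
  where the finite type 'n indexes coordinates (so n = CARD('n)).
  Operators on H^n are n x n matrices acting via *v.\<close>

section \<open>Real case\<close>

definition r_frame :: "(nat \<Rightarrow> real ^ 'n) \<Rightarrow> nat \<Rightarrow> bool" where
  "r_frame x m \<longleftrightarrow> (\<exists>A B. 0 < A \<and> 0 < B \<and>
     (\<forall>v. A * (norm v)\<^sup>2 \<le> (\<Sum>k\<in>{1..m}. (v \<bullet> x k)\<^sup>2)
        \<and> (\<Sum>k\<in>{1..m}. (v \<bullet> x k)\<^sup>2) \<le> B * (norm v)\<^sup>2))"

definition r_self_adjoint :: "real ^ 'n ^ 'n \<Rightarrow> bool" where
  "r_self_adjoint T \<longleftrightarrow> (\<forall>u v. (T *v u) \<bullet> v = u \<bullet> (T *v v))"

definition r_injective :: "(nat \<Rightarrow> real ^ 'n) \<Rightarrow> nat \<Rightarrow> bool" where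
  "r_injective x m \<longleftrightarrow> (\<forall>T. r_self_adjoint T \<longrightarrow>
     (\<forall>k\<in>{1..m}. (T *v x k) \<bullet> x k = 0) \<longrightarrow> T = 0)"

definition r_onb :: "('n \<Rightarrow> real ^ 'n) \<Rightarrow> bool" where
  "r_onb e \<longleftrightarrow> (\<forall>i j. e i \<bullet> e j = (if i = j then 1 else 0))
     \<and> (\<forall>v. \<exists>c. v = (\<Sum>j\<in>UNIV. c j *\<^sub>R e j))"

section \<open>Complex case\<close>

definition c_inner :: "complex ^ 'n \<Rightarrow> complex ^ 'n \<Rightarrow> complex" where
  "c_inner u v = (\<Sum>i\<in>UNIV. u $ i * cnj (v $ i))"

definition c_frame :: "(nat \<Rightarrow> complex ^ 'n) \<Rightarrow> nat \<Rightarrow> bool" where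
  "c_frame x m \<longleftrightarrow> (\<exists>A B. 0 < A \<and> 0 < B \<and>
     (\<forall>v. A * (norm v)\<^sup>2 \<le> (\<Sum>k\<in>{1..m}. (cmod (c_inner v (x k)))\<^sup>2)
        \<and> (\<Sum>k\<in>{1..m}. (cmod (c_inner v (x k)))\<^sup>2) \<le> B * (norm v)\<^sup>2))"

definition c_self_adjoint :: "complex ^ 'n ^ 'n \<Rightarrow> bool" where
  "c_self_adjoint T \<longleftrightarrow> (\<forall>u v. c_inner (T *v u) v = c_inner u (T *v v))"

definition c_injective :: "(nat \<Rightarrow> complex ^ 'n) \<Rightarrow> nat \<Rightarrow> bool" where
  "c_injective x m \<longleftrightarrow> (\<forall>T. c_self_adjoint T \<longrightarrow>
     (\<forall>k\<in>{1..m}. c_inner (T *v x k) (x k) = 0) \<longrightarrow> T = 0)"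

definition c_onb :: "('n \<Rightarrow> complex ^ 'n) \<Rightarrow> bool" where
  "c_onb e \<longleftrightarrow> (\<forall>i j. c_inner (e i) (e j) = (if i = j then 1 else 0))
     \<and> (\<forall>v. \<exists>c. v = (\<Sum>j\<in>UNIV. c j *s e j))"

end

theory Submission
  imports Defs
begin

text \<open>For an orthonormal basis \<open>e\<close> and \<open>d \<in> \<real>\<^sup>n\<close>, the operator
  \<open>T = \<Sum>\<^sub>j d\<^sub>j e\<^sub>j e\<^sub>j\<^sup>*\<close> is self-adjoint and
  \<open>\<langle>T x, x\<rangle> = d \<bullet> (|\<langle>x, e\<^sub>j\<rangle>|\<^sup>2)\<^sub>j\<close>.
  So the squared coordinate vectors of the \<open>x\<^sub>k\<close> fail to span \<open>\<real>\<^sup>n\<close> for some basis \<open>e\<close>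
  exactly when a nonzero operator diagonal in \<open>e\<close> has vanishing quadratic form at every
  \<open>x\<^sub>k\<close>. By the spectral theorem every self-adjoint operator is diagonal in some orthonormal
  basis, so this happens exactly when the family is not injective.

  The spectral theorem is obtained by exhausting the space with orthonormal eigenvectors: the
  orthogonal complement of finitely many eigenvectors is invariant, and a maximiser of the
  Rayleigh quotient on its unit sphere is again an eigenvector. In the complex case this
  Euclidean argument is applied to the real inner product \<open>Re \<langle>_, _\<rangle>\<close>, for which a
  self-adjoint operator is symmetric.\<close>

lemma linear_coeff_zero_if_quadratic_nonpos:
  fixes a b :: real
  assumes "\<And>t. a * t + b * t\<^sup>2 \<le> 0"
  shows "a = 0"
proof (rule ccontr)
  assume "a \<noteq> 0"
  define c where "c = \<bar>b\<bar> + 1"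
  have "c > 0" "c + b > 0" unfolding c_def by linarith+
  have "a * (a / c) + b * (a / c)\<^sup>2 = a\<^sup>2 * (c + b) / c\<^sup>2"
    using \<open>c > 0\<close> by (simp add: power2_eq_square field_simps)
  also have "\<dots> > 0"
    using \<open>a \<noteq> 0\<close> \<open>c > 0\<close> \<open>c + b > 0\<close> by simp
  finally show False using assms[of "a / c"] by linarith
qed

lemma rayleigh_quotient_attains_max:
  fixes L :: "'a::euclidean_space \<Rightarrow> 'a"
  assumes "linear L" "subspace S" "S \<noteq> {0}"
  obtains v where "v \<in> S" "norm v = 1" "\<And>u. u \<in> S \<Longrightarrow> L u \<bullet> u \<le> (L v \<bullet> v) * (u \<bullet> u)"
proof -
  define K where "K = sphere 0 1 \<inter> S"
  have "compact K"
    unfolding K_def by (intro compact_Int_closed compact_sphere closed_subspace assms)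
  obtain x where "x \<in> S" "x \<noteq> 0" using assms(2,3) subspace_0 by blast
  then have "x /\<^sub>R norm x \<in> K"
    unfolding K_def using assms(2) by (simp add: subspace_scale)
  moreover have "continuous_on K (\<lambda>u. L u \<bullet> u)"
    using assms(1) by (intro continuous_intros linear_continuous_on linear_conv_bounded_linear[THEN iffD1])
  ultimately obtain v where "v \<in> K" and vmax: "\<And>y. y \<in> K \<Longrightarrow> L y \<bullet> y \<le> L v \<bullet> v"
    using continuous_attains_sup[OF \<open>compact K\<close>] by blast
  have "L u \<bullet> u \<le> (L v \<bullet> v) * (u \<bullet> u)" if "u \<in> S" for u
  proof (cases "u = 0")
    case True
    then show ?thesis using linear_0[OF assms(1)] by simp
  next
    case False
    then have "u /\<^sub>R norm u \<in> K"
      unfolding K_def using that assms(2) by (simp add: subspace_scale)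
    then have "(L u \<bullet> u) / (norm u)\<^sup>2 \<le> L v \<bullet> v"
      using vmax[of "u /\<^sub>R norm u"] by (simp add: linear_scale[OF assms(1)] power2_eq_square divide_inverse mult_ac)
    then show ?thesis
      using False by (simp add: divide_le_eq power2_norm_eq_inner)
  qed
  then show ?thesis using that \<open>v \<in> K\<close> unfolding K_def by auto
qed

lemma symmetric_eigenvector_in_invariant_subspace:
  fixes L :: "'a::euclidean_space \<Rightarrow> 'a"
  assumes lin: "linear L" and sym: "\<And>u v. L u \<bullet> v = u \<bullet> L v"
    and S: "subspace S" "L ` S \<subseteq> S" "S \<noteq> {0}"
  obtains v where "v \<in> S" "norm v = 1" "L v = (L v \<bullet> v) *\<^sub>R v"
proof -
  obtain v where v: "v \<in> S" "norm v = 1"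
    and max: "\<And>u. u \<in> S \<Longrightarrow> L u \<bullet> u \<le> (L v \<bullet> v) * (u \<bullet> u)"
    using rayleigh_quotient_attains_max[OF lin S(1,3)] by blast
  have vv: "v \<bullet> v = 1" using v(2) by (simp add: norm_eq_1)
  \<comment> \<open>the Rayleigh quotient along \<open>v + t w\<close> has a maximum at \<open>t = 0\<close>, so its linear term vanishes\<close>
  have perp: "2 * (L v \<bullet> w) = 0" if "w \<in> S" "w \<bullet> v = 0" for w
  proof (rule linear_coeff_zero_if_quadratic_nonpos)
    fix t :: real
    have "v + t *\<^sub>R w \<in> S" using S(1) v(1) that(1) by (simp add: subspace_add subspace_scale)
    from max[OF this] show "2 * (L v \<bullet> w) * t + (L w \<bullet> w - (L v \<bullet> v) * (w \<bullet> w)) * t\<^sup>2 \<le> 0"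
      using sym[of w v] vv that(2)
      by (simp add: linear_add[OF lin] linear_scale[OF lin] inner_add_left inner_add_right
          inner_commute power2_eq_square algebra_simps)
  qed
  define w where "w = L v - (L v \<bullet> v) *\<^sub>R v"
  have "w \<in> S" unfolding w_def using S v(1) by (auto intro: subspace_diff subspace_scale)
  moreover have "w \<bullet> v = 0" unfolding w_def using vv by (simp add: inner_diff_left)
  ultimately have "L v \<bullet> w = 0" "v \<bullet> w = 0"
    using perp by (simp_all add: inner_commute)
  then have "w \<bullet> w = 0" unfolding w_def by (simp add: inner_diff_left)
  then show ?thesis using that v unfolding w_def by simp
qed

lemma saturated_set_exists:
  assumes "P {}" and bound: "\<And>A. P A \<Longrightarrow> finite A \<and> card A \<le> N"
    and extend: "\<And>A. P A \<Longrightarrow> \<not> Q A \<Longrightarrow> \<exists>v. v \<notin> A \<and> P (insert v A)"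
  obtains A where "finite A" "P A" "Q A"
proof -
  obtain A where "P A" and max: "\<And>B. P B \<Longrightarrow> card B \<le> card A"
    using ex_has_greatest_nat[of P "{}" card "Suc N"] assms(1) bound by (metis le_imp_less_Suc)
  show ?thesis
  proof (cases "Q A")
    case False
    then obtain v where "v \<notin> A" "P (insert v A)" using extend \<open>P A\<close> by blast
    then show ?thesis using max[of "insert v A"] bound[OF \<open>P A\<close>] by simp
  qed (use that \<open>P A\<close> bound in blast)
qed

lemma span_eq_UNIV_iff_perp_zero:
  fixes D :: "'a::euclidean_space set"
  shows "span D = UNIV \<longleftrightarrow> (\<forall>d. (\<forall>y\<in>D. d \<bullet> y = 0) \<longrightarrow> d = 0)"
proof
  assume "span D = UNIV"
  show "\<forall>d. (\<forall>y\<in>D. d \<bullet> y = 0) \<longrightarrow> d = 0"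
  proof (intro allI impI)
    fix d assume "\<forall>y\<in>D. d \<bullet> y = 0"
    then have "span D \<subseteq> {y. d \<bullet> y = 0}"
      by (intro span_minimal) (auto simp: subspace_def inner_add_right)
    then have "d \<bullet> d = 0" using \<open>span D = UNIV\<close> by blast
    then show "d = 0" by simp
  qed
next
  assume perp: "\<forall>d. (\<forall>y\<in>D. d \<bullet> y = 0) \<longrightarrow> d = 0"
  show "span D = UNIV"
  proof (rule ccontr)
    assume "span D \<noteq> UNIV"
    then have "dim D < DIM('a)" using dim_eq_full dim_subset_UNIV[of D] by (metis le_neq_implies_less)
    then obtain d where "d \<noteq> 0" "\<And>y. y \<in> span D \<Longrightarrow> orthogonal d y"
      using orthogonal_to_subspace_exists by blast
    then show False using perp span_base unfolding orthogonal_def by blast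
  qed
qed

lemma symmetric_orthonormal_eigenbasis:
  fixes L :: "'a::euclidean_space \<Rightarrow> 'a"
  assumes lin: "linear L" and sym: "\<And>u v. L u \<bullet> v = u \<bullet> L v"
  obtains B where "pairwise orthogonal B" "\<forall>b\<in>B. norm b = 1 \<and> (\<exists>l. L b = l *\<^sub>R b)"
    "span B = UNIV"
proof (rule saturated_set_exists[where Q = "\<lambda>B. span B = UNIV"])
  let ?P = "\<lambda>B. pairwise orthogonal B \<and> (\<forall>b\<in>B. norm b = 1 \<and> (\<exists>l. L b = l *\<^sub>R b))"
  show "?P {}" by simp
  show "finite B \<and> card B \<le> DIM('a)" if "?P B" for B
    using that pairwise_orthogonal_independent[of B] independent_bound by force
  show "\<exists>v. v \<notin> B \<and> ?P (insert v B)" if B: "?P B" "span B \<noteq> UNIV" for B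
  proof -
    define S where "S = {u. \<forall>b\<in>B. u \<bullet> b = 0}"
    have "subspace S" unfolding S_def by (auto simp: subspace_def inner_add_left)
    moreover have "L ` S \<subseteq> S"
    proof (clarsimp simp: S_def)
      fix u b assume "\<forall>b\<in>B. u \<bullet> b = 0" "b \<in> B"
      moreover obtain l where "L b = l *\<^sub>R b" using B(1) \<open>b \<in> B\<close> by blast
      ultimately show "L u \<bullet> b = 0" by (simp add: sym)
    qed
    moreover have "S \<noteq> {0}"
      using B(2) unfolding span_eq_UNIV_iff_perp_zero S_def by auto
    ultimately obtain v where v: "v \<in> S" "norm v = 1" "L v = (L v \<bullet> v) *\<^sub>R v"
      using symmetric_eigenvector_in_invariant_subspace[OF lin sym] by blast
    have "v \<notin> B" using v(1,2) unfolding S_def by (auto simp: norm_eq_1)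
    moreover have "?P (insert v B)"
      using B(1) v unfolding S_def
      by (auto intro!: pairwise_orthogonal_insert simp: orthogonal_def inner_commute)
    ultimately show ?thesis by blast
  qed
qed (use that in blast)

definition r_diag :: "('n \<Rightarrow> real ^ 'n) \<Rightarrow> real ^ 'n \<Rightarrow> real ^ 'n ^ 'n" where
  "r_diag e d = (\<chi> i l. \<Sum>j\<in>UNIV. d $ j * (e j $ i * e j $ l))"

lemma r_diag_mult_vec: "r_diag e d *v u = (\<Sum>j\<in>UNIV. (d $ j * (u \<bullet> e j)) *\<^sub>R e j)"
proof -
  have "(r_diag e d *v u) $ i = (\<Sum>j\<in>UNIV. d $ j * (u \<bullet> e j) * e j $ i)" for i
  proof -
    have "(r_diag e d *v u) $ i = (\<Sum>l\<in>UNIV. \<Sum>j\<in>UNIV. d $ j * (e j $ i * e j $ l) * u $ l)"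
      unfolding r_diag_def by (simp add: matrix_vector_mult_def sum_distrib_right)
    also have "\<dots> = (\<Sum>j\<in>UNIV. d $ j * (u \<bullet> e j) * e j $ i)"
      by (subst sum.swap) (simp add: inner_vec_def sum_distrib_left sum_distrib_right mult_ac)
    finally show ?thesis .
  qed
  then show ?thesis by (simp add: vec_eq_iff sum_component)
qed

lemma r_self_adjoint_diag: "r_self_adjoint (r_diag e d)"
  unfolding r_self_adjoint_def r_diag_mult_vec
  by (simp add: inner_sum_left inner_sum_right mult_ac inner_commute)

lemma r_diag_quadratic_form: "(r_diag e d *v u) \<bullet> u = d \<bullet> (\<chi> j. (u \<bullet> e j)\<^sup>2)"
proof -
  have "(r_diag e d *v u) \<bullet> u = (\<Sum>j\<in>UNIV. d $ j * (u \<bullet> e j) * (e j \<bullet> u))"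
    by (simp add: r_diag_mult_vec inner_sum_left)
  also have "\<dots> = (\<Sum>j\<in>UNIV. d $ j * (u \<bullet> e j)\<^sup>2)"
    by (simp add: inner_commute power2_eq_square mult.assoc)
  finally show ?thesis by (simp add: inner_vec_def)
qed

lemma r_onb_inner:
  assumes "r_onb e"
  shows "e j \<bullet> e i = (if j = i then 1 else 0)"
  using assms unfolding r_onb_def by blast

lemma r_onb_diag_mult_basis:
  assumes "r_onb e"
  shows "r_diag e d *v e i = d $ i *\<^sub>R e i"
  unfolding r_diag_mult_vec
  by (simp add: r_onb_inner[OF assms] inner_commute[of "e i"] if_distrib[of "\<lambda>c. (_ * c) *\<^sub>R _"] cong: if_cong)

lemma r_onb_expansion:
  assumes "r_onb e"
  shows "v = (\<Sum>j\<in>UNIV. (v \<bullet> e j) *\<^sub>R e j)"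
proof -
  obtain c where c: "v = (\<Sum>j\<in>UNIV. c j *\<^sub>R e j)" using assms unfolding r_onb_def by blast
  have "v \<bullet> e i = c i" for i
    by (subst c) (simp add: inner_sum_left r_onb_inner[OF assms] if_distrib cong: if_cong)
  then show ?thesis using c by simp
qed

lemma r_onb_matrix_eq:
  assumes "r_onb e" "\<And>j. A *v e j = B *v e j"
  shows "A = B"
proof (rule matrix_eq[THEN iffD2], rule allI)
  fix v
  have "A *v v = A *v (\<Sum>j\<in>UNIV. (v \<bullet> e j) *\<^sub>R e j)" using r_onb_expansion[OF assms(1)] by metis
  also have "\<dots> = B *v (\<Sum>j\<in>UNIV. (v \<bullet> e j) *\<^sub>R e j)"
    by (simp add: linear_sum[OF matrix_vector_mul_linear] matrix_vector_mult_scaleR assms(2))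
  finally show "A *v v = B *v v" using r_onb_expansion[OF assms(1)] by metis
qed

lemma r_onb_diag_eq_0_iff:
  assumes "r_onb e"
  shows "r_diag e d = 0 \<longleftrightarrow> d = 0"
proof
  assume "r_diag e d = 0"
  then have "d $ i *\<^sub>R e i = 0" for i by (metis r_onb_diag_mult_basis[OF assms] matrix_vector_mult_0)
  moreover have "e i \<noteq> 0" for i using r_onb_inner[OF assms, of i i] by auto
  ultimately have "d $ i = 0" for i by simp
  then show "d = 0" by (simp add: vec_eq_iff)
qed (simp add: r_diag_def vec_eq_iff)

lemma r_onb_of_orthonormal_basis:
  assumes e: "bij_betw e UNIV B" and B: "pairwise orthogonal B" "\<forall>b\<in>B. norm b = 1" "span B = UNIV"
  shows "r_onb e"
  unfolding r_onb_def
proof (intro conjI allI)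
  fix i j
  have "e i \<in> B" "e j \<in> B" using bij_betwE[OF e] by blast+
  moreover have "e i = e j \<longleftrightarrow> i = j" using bij_betw_imp_inj_on[OF e] by (auto dest: inj_onD)
  ultimately show "e i \<bullet> e j = (if i = j then 1 else 0)"
    using B(1,2) by (auto simp: pairwise_def orthogonal_def norm_eq_1)
next
  fix v
  have "finite B" using bij_betw_finite[OF e] by simp
  then obtain c where "v = (\<Sum>b\<in>B. c b *\<^sub>R b)" using B(3) span_finite[of B] by auto
  also have "\<dots> = (\<Sum>j\<in>UNIV. c (e j) *\<^sub>R e j)" by (rule sum.reindex_bij_betw[OF e, symmetric])
  finally show "\<exists>c. v = (\<Sum>j\<in>UNIV. c j *\<^sub>R e j)" by (intro exI[of _ "\<lambda>j. c (e j)"])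
qed

lemma r_self_adjoint_diagonalizable:
  fixes T :: "real ^ 'n ^ 'n"
  assumes "r_self_adjoint T"
  obtains e d where "r_onb e" "T = r_diag e d"
proof -
  obtain B where B: "pairwise orthogonal B" "\<forall>b\<in>B. norm b = 1 \<and> (\<exists>l. T *v b = l *\<^sub>R b)"
    "span B = UNIV"
    using symmetric_orthonormal_eigenbasis[OF matrix_vector_mul_linear, of T] assms
    unfolding r_self_adjoint_def by blast
  have "independent B" using B(1,2) by (intro pairwise_orthogonal_independent) auto
  then have "finite B" "card B = dim (span B)" by (simp_all add: indep_card_eq_dim_span)
  then have "card B = CARD('n)" using B(3) by simp
  then obtain e :: "'n \<Rightarrow> real ^ 'n" where e: "bij_betw e UNIV B"
    using \<open>finite B\<close> finite_same_card_bij[of "UNIV :: 'n set" B] by auto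
  then have onb: "r_onb e" using B by (intro r_onb_of_orthonormal_basis) auto
  have "\<forall>j. \<exists>l. T *v e j = l *\<^sub>R e j" using B(2) bij_betwE[OF e] by blast
  then obtain l where "\<And>j. T *v e j = l j *\<^sub>R e j" by metis
  then have "T = r_diag e (\<chi> j. l j)"
    by (intro r_onb_matrix_eq[OF onb]) (simp add: r_onb_diag_mult_basis[OF onb])
  with onb that show ?thesis by blast
qed

lemma r_injective_iff_span_squared_coordinates:
  fixes x :: "nat \<Rightarrow> real ^ 'n"
  shows "r_injective x m \<longleftrightarrow>
     (\<forall>e. r_onb e \<longrightarrow> span ((\<lambda>k. \<chi> j. (x k \<bullet> e j)\<^sup>2) ` {1..m}) = UNIV)"
proof (intro iffI allI impI)
  fix e :: "'n \<Rightarrow> real ^ 'n" assume inj: "r_injective x m" and "r_onb e"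
  show "span ((\<lambda>k. \<chi> j. (x k \<bullet> e j)\<^sup>2) ` {1..m}) = UNIV"
    unfolding span_eq_UNIV_iff_perp_zero
  proof (intro allI impI)
    fix d assume "\<forall>y\<in>(\<lambda>k. \<chi> j. (x k \<bullet> e j)\<^sup>2) ` {1..m}. d \<bullet> y = 0"
    then have "\<forall>k\<in>{1..m}. (r_diag e d *v x k) \<bullet> x k = 0"
      by (simp add: r_diag_quadratic_form)
    then have "r_diag e d = 0"
      using inj r_self_adjoint_diag unfolding r_injective_def by blast
    then show "d = 0" using r_onb_diag_eq_0_iff[OF \<open>r_onb e\<close>] by blast
  qed
next
  assume span: "\<forall>e. r_onb e \<longrightarrow> span ((\<lambda>k. \<chi> j. (x k \<bullet> e j)\<^sup>2) ` {1..m}) = UNIV"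
  show "r_injective x m"
    unfolding r_injective_def
  proof (intro allI impI)
    fix T assume "r_self_adjoint T" and zero: "\<forall>k\<in>{1..m}. (T *v x k) \<bullet> x k = 0"
    from \<open>r_self_adjoint T\<close> obtain e d where "r_onb e" and T: "T = r_diag e d"
      by (rule r_self_adjoint_diagonalizable)
    have "\<forall>y\<in>(\<lambda>k. \<chi> j. (x k \<bullet> e j)\<^sup>2) ` {1..m}. d \<bullet> y = 0"
      using zero by (simp add: T r_diag_quadratic_form)
    then have "d = 0"
      using span \<open>r_onb e\<close> unfolding span_eq_UNIV_iff_perp_zero by blast
    then show "T = 0" using r_onb_diag_eq_0_iff[OF \<open>r_onb e\<close>] T by blast
  qed
qed

lemma c_inner_zero_left [simp]: "c_inner 0 v = 0"
  by (simp add: c_inner_def)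

lemma c_inner_add_left: "c_inner (u + w) v = c_inner u v + c_inner w v"
  by (simp add: c_inner_def distrib_right sum.distrib)

lemma c_inner_diff_left: "c_inner (u - w) v = c_inner u v - c_inner w v"
  by (simp add: c_inner_def left_diff_distrib sum_subtractf)

lemma c_inner_scale_left: "c_inner (c *s u) v = c * c_inner u v"
  by (simp add: c_inner_def sum_distrib_left mult_ac)

lemma c_inner_scale_right: "c_inner u (c *s v) = cnj c * c_inner u v"
  by (simp add: c_inner_def sum_distrib_left mult_ac)

lemma scaleR_eq_of_real_scale: "r *\<^sub>R (u :: complex ^ 'n) = complex_of_real r *s u"
  unfolding vec_eq_iff vector_scaleR_component vector_smult_component by (simp add: scaleR_conv_of_real)

lemma c_inner_sum_left: "c_inner (\<Sum>b\<in>B. f b) v = (\<Sum>b\<in>B. c_inner (f b) v)"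
  by (simp add: c_inner_def sum_distrib_right sum_component sum.swap[of _ B])

lemma c_inner_sum_right: "c_inner v (\<Sum>b\<in>B. f b) = (\<Sum>b\<in>B. c_inner v (f b))"
  by (simp add: c_inner_def sum_distrib_left sum_component sum.swap[of _ B])

lemma c_inner_commute: "c_inner v u = cnj (c_inner u v)"
  by (simp add: c_inner_def mult.commute)

lemma Re_c_inner: "Re (c_inner u v) = u \<bullet> v"
  by (simp add: c_inner_def inner_vec_def inner_complex_def Re_sum)

lemma c_inner_self: "c_inner u u = complex_of_real ((norm u)\<^sup>2)"
proof -
  have "Im (c_inner u u) = 0" by (simp add: c_inner_def Im_sum)
  then show ?thesis by (simp add: complex_eq_iff Re_c_inner power2_norm_eq_inner)
qed

definition c_diag :: "('n \<Rightarrow> complex ^ 'n) \<Rightarrow> real ^ 'n \<Rightarrow> complex ^ 'n ^ 'n" where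
  "c_diag e d = (\<chi> i l. \<Sum>j\<in>UNIV. complex_of_real (d $ j) * (e j $ i * cnj (e j $ l)))"

lemma c_diag_mult_vec:
  "c_diag e d *v u = (\<Sum>j\<in>UNIV. (complex_of_real (d $ j) * c_inner u (e j)) *s e j)"
proof -
  have "(c_diag e d *v u) $ i = (\<Sum>j\<in>UNIV. complex_of_real (d $ j) * c_inner u (e j) * e j $ i)" for i
  proof -
    have "(c_diag e d *v u) $ i
        = (\<Sum>l\<in>UNIV. \<Sum>j\<in>UNIV. complex_of_real (d $ j) * (e j $ i * cnj (e j $ l)) * u $ l)"
      unfolding c_diag_def by (simp add: matrix_vector_mult_def sum_distrib_right)
    also have "\<dots> = (\<Sum>j\<in>UNIV. complex_of_real (d $ j) * c_inner u (e j) * e j $ i)"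
      by (subst sum.swap) (simp add: c_inner_def sum_distrib_left sum_distrib_right mult_ac)
    finally show ?thesis .
  qed
  then show ?thesis by (simp add: vec_eq_iff sum_component)
qed

lemma c_self_adjoint_diag: "c_self_adjoint (c_diag e d)"
  unfolding c_self_adjoint_def c_diag_mult_vec c_inner_sum_left c_inner_sum_right
    c_inner_scale_left c_inner_scale_right
  by (simp add: c_inner_commute[of "e _"] mult_ac)

lemma c_diag_quadratic_form:
  "c_inner (c_diag e d *v u) u = complex_of_real (d \<bullet> (\<chi> j. (cmod (c_inner u (e j)))\<^sup>2))"
proof -
  have "c_inner (c_diag e d *v u) u
      = (\<Sum>j\<in>UNIV. complex_of_real (d $ j) * (c_inner u (e j) * cnj (c_inner u (e j))))"
    by (simp add: c_diag_mult_vec c_inner_sum_left c_inner_scale_left c_inner_commute[of "e _" u] mult_ac)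
  also have "\<dots> = complex_of_real (\<Sum>j\<in>UNIV. d $ j * (cmod (c_inner u (e j)))\<^sup>2)"
    by (simp add: complex_norm_square[symmetric])
  finally show ?thesis by (simp add: inner_vec_def)
qed

lemma c_onb_inner:
  assumes "c_onb e"
  shows "c_inner (e j) (e i) = (if j = i then 1 else 0)"
  using assms unfolding c_onb_def by blast

lemma c_onb_diag_mult_basis:
  assumes "c_onb e"
  shows "c_diag e d *v e i = complex_of_real (d $ i) *s e i"
  unfolding c_diag_mult_vec
  by (simp add: c_onb_inner[OF assms] if_distrib[of "\<lambda>c. (_ * c) *s _"] cong: if_cong)

lemma c_onb_expansion:
  assumes "c_onb e"
  shows "v = (\<Sum>j\<in>UNIV. c_inner v (e j) *s e j)"
proof -
  obtain c where c: "v = (\<Sum>j\<in>UNIV. c j *s e j)" using assms unfolding c_onb_def by blast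
  have "c_inner v (e i) = c i" for i
    by (subst c) (simp add: c_inner_sum_left c_inner_scale_left c_onb_inner[OF assms]
        if_distrib[of "\<lambda>x. _ * x"] cong: if_cong)
  then show ?thesis using c by simp
qed

lemma c_onb_matrix_eq:
  assumes "c_onb e" "\<And>j. A *v e j = B *v e j"
  shows "A = B"
proof (rule matrix_eq[THEN iffD2], rule allI)
  fix v
  have "A *v v = A *v (\<Sum>j\<in>UNIV. c_inner v (e j) *s e j)" using c_onb_expansion[OF assms(1)] by metis
  also have "\<dots> = B *v (\<Sum>j\<in>UNIV. c_inner v (e j) *s e j)"
    by (simp add: linear_sum[OF matrix_vector_mul_linear] vec.scale assms(2))
  finally show "A *v v = B *v v" using c_onb_expansion[OF assms(1)] by metis
qed

lemma c_onb_diag_eq_0_iff: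
  assumes "c_onb e"
  shows "c_diag e d = 0 \<longleftrightarrow> d = 0"
proof
  assume "c_diag e d = 0"
  then have "complex_of_real (d $ i) *s e i = 0" for i
    by (metis c_onb_diag_mult_basis[OF assms] matrix_vector_mult_0)
  moreover have "e i \<noteq> 0" for i using c_onb_inner[OF assms, of i i] by (auto simp: c_inner_def)
  ultimately have "d $ i = 0" for i by (simp add: vec.scale_eq_0_iff)
  then show "d = 0" by (simp add: vec_eq_iff)
qed (simp add: c_diag_def vec_eq_iff)

lemma c_self_adjoint_orthonormal_eigenbasis:
  fixes T :: "complex ^ 'n ^ 'n"
  assumes sa: "c_self_adjoint T"
  obtains B where "finite B" "\<forall>a\<in>B. \<forall>b\<in>B. c_inner a b = (if a = b then 1 else 0)"
    "\<forall>b\<in>B. \<exists>l. T *v b = l *\<^sub>R b" "\<forall>u. (\<forall>b\<in>B. c_inner u b = 0) \<longrightarrow> u = 0"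
proof (rule saturated_set_exists[where Q = "\<lambda>B. \<forall>u. (\<forall>b\<in>B. c_inner u b = 0) \<longrightarrow> u = 0"])
  let ?P = "\<lambda>B. (\<forall>a\<in>B. \<forall>b\<in>B. c_inner a b = (if a = b then 1 else 0))
    \<and> (\<forall>b\<in>B. \<exists>l. T *v b = l *\<^sub>R b)"
  show "?P {}" by simp
  show "finite B \<and> card B \<le> DIM(complex ^ 'n)" if "?P B" for B
  proof -
    have "pairwise orthogonal B"
      using that by (auto simp: pairwise_def orthogonal_def Re_c_inner[symmetric])
    moreover have "0 \<notin> B"
      using that c_inner_zero_left[of "0 :: complex ^ 'n"] by (metis zero_neq_one)
    ultimately show ?thesis using pairwise_orthogonal_independent independent_bound by blast
  qed
  have sym: "\<And>u v. (T *v u) \<bullet> v = u \<bullet> (T *v v)"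
    using sa unfolding c_self_adjoint_def by (metis Re_c_inner)
  show "\<exists>v. v \<notin> B \<and> ?P (insert v B)"
    if B: "?P B" "\<not> (\<forall>u. (\<forall>b\<in>B. c_inner u b = 0) \<longrightarrow> u = 0)" for B
  proof -
    define S where "S = {u. \<forall>b\<in>B. c_inner u b = 0}"
    have "subspace S"
      unfolding S_def by (auto simp: subspace_def c_inner_add_left scaleR_eq_of_real_scale c_inner_scale_left)
    moreover have "(*v) T ` S \<subseteq> S"
    proof (clarsimp simp: S_def)
      fix u b assume "\<forall>b\<in>B. c_inner u b = 0" "b \<in> B"
      moreover obtain l where "T *v b = l *\<^sub>R b" using B(1) \<open>b \<in> B\<close> by blast
      moreover have "c_inner (T *v u) b = c_inner u (T *v b)" using sa unfolding c_self_adjoint_def by blast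
      ultimately show "c_inner (T *v u) b = 0" by (simp add: scaleR_eq_of_real_scale c_inner_scale_right)
    qed
    moreover have "S \<noteq> {0}" using B(2) unfolding S_def by auto
    ultimately obtain v where v: "v \<in> S" "norm v = 1" "T *v v = ((T *v v) \<bullet> v) *\<^sub>R v"
      using symmetric_eigenvector_in_invariant_subspace[OF matrix_vector_mul_linear sym] by blast
    have vv: "c_inner v v = 1" using v(2) by (simp add: c_inner_self)
    have perp: "c_inner v b = 0" "c_inner b v = 0" if "b \<in> B" for b
      using v(1) that c_inner_commute[of b v] unfolding S_def by auto
    have "v \<notin> B" using perp(1)[of v] vv by auto
    moreover have "\<forall>a\<in>insert v B. \<forall>b\<in>insert v B. c_inner a b = (if a = b then 1 else 0)"
      using B(1) vv perp \<open>v \<notin> B\<close> by auto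
    moreover have "\<forall>b\<in>insert v B. \<exists>l. T *v b = l *\<^sub>R b" using B(1) v(3) by blast
    ultimately show ?thesis by blast
  qed
qed (use that in blast)

lemma c_orthonormal_complete_expansion:
  assumes "finite B" and orth: "\<forall>a\<in>B. \<forall>b\<in>B. c_inner a b = (if a = b then 1 else 0)"
    and complete: "\<forall>u. (\<forall>b\<in>B. c_inner u b = 0) \<longrightarrow> u = 0"
  shows "u = (\<Sum>b\<in>B. c_inner u b *s b)"
proof -
  have "c_inner (\<Sum>b\<in>B. c_inner u b *s b) a = c_inner u a" if "a \<in> B" for a
    using assms(1) that orth
    by (simp add: c_inner_sum_left c_inner_scale_left if_distrib[of "\<lambda>x. _ * x"] cong: if_cong)
  then have "\<forall>a\<in>B. c_inner (u - (\<Sum>b\<in>B. c_inner u b *s b)) a = 0" by (simp add: c_inner_diff_left)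
  then have "u - (\<Sum>b\<in>B. c_inner u b *s b) = 0" using complete by blast
  then show ?thesis by simp
qed

lemma c_orthonormal_independent:
  assumes "finite B" and orth: "\<forall>a\<in>B. \<forall>b\<in>B. c_inner a b = (if a = b then 1 else 0)"
  shows "vec.independent B"
  unfolding vec.independent_explicit
proof (intro conjI allI impI ballI)
  fix c a assume "(\<Sum>b\<in>B. c b *s b) = 0" "a \<in> B"
  then have "0 = c_inner (\<Sum>b\<in>B. c b *s b) a" by simp
  also have "\<dots> = c a" using assms(1) \<open>a \<in> B\<close> orth
    by (simp add: c_inner_sum_left c_inner_scale_left if_distrib[of "\<lambda>x. _ * x"] cong: if_cong)
  finally show "c a = 0" ..
qed (rule assms(1))

lemma c_onb_of_orthonormal_basis:
  assumes e: "bij_betw e UNIV B"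
    and orth: "\<forall>a\<in>B. \<forall>b\<in>B. c_inner a b = (if a = b then 1 else 0)"
    and expansion: "\<And>u. u = (\<Sum>b\<in>B. c_inner u b *s b)"
  shows "c_onb e"
  unfolding c_onb_def
proof (intro conjI allI)
  fix i j
  have "e i \<in> B" "e j \<in> B" using bij_betwE[OF e] by blast+
  moreover have "e i = e j \<longleftrightarrow> i = j" using bij_betw_imp_inj_on[OF e] by (auto dest: inj_onD)
  ultimately show "c_inner (e i) (e j) = (if i = j then 1 else 0)" using orth by simp
next
  fix v
  have "v = (\<Sum>b\<in>B. c_inner v b *s b)" by (rule expansion)
  also have "\<dots> = (\<Sum>j\<in>UNIV. c_inner v (e j) *s e j)"
    by (rule sum.reindex_bij_betw[OF e, symmetric])
  finally show "\<exists>c. v = (\<Sum>j\<in>UNIV. c j *s e j)" by (intro exI[of _ "\<lambda>j. c_inner v (e j)"])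
qed

lemma c_self_adjoint_diagonalizable:
  fixes T :: "complex ^ 'n ^ 'n"
  assumes "c_self_adjoint T"
  obtains e d where "c_onb e" "T = c_diag e d"
proof -
  obtain B where B: "finite B" and orth: "\<forall>a\<in>B. \<forall>b\<in>B. c_inner a b = (if a = b then 1 else 0)"
    and eigen: "\<forall>b\<in>B. \<exists>l. T *v b = l *\<^sub>R b" and complete: "\<forall>u. (\<forall>b\<in>B. c_inner u b = 0) \<longrightarrow> u = 0"
    using c_self_adjoint_orthonormal_eigenbasis[OF assms] by blast
  have expansion: "u = (\<Sum>b\<in>B. c_inner u b *s b)" for u
    using c_orthonormal_complete_expansion[OF B orth complete] .
  have "u \<in> vec.span B" for u
    by (subst expansion) (intro vec.span_sum vec.span_scale vec.span_base)
  then have "vec.span B = UNIV" by auto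
  have "card B = vec.dim (vec.span B)"
    using vec.dim_span_eq_card_independent[OF c_orthonormal_independent[OF B orth]] by simp
  also have "\<dots> = CARD('n)" using \<open>vec.span B = UNIV\<close> vec_dim_card by simp
  finally obtain e :: "'n \<Rightarrow> complex ^ 'n" where e: "bij_betw e UNIV B"
    using B finite_same_card_bij[of "UNIV :: 'n set" B] by auto
  then have onb: "c_onb e" using orth expansion by (rule c_onb_of_orthonormal_basis)
  have "\<forall>j. \<exists>l. T *v e j = l *\<^sub>R e j" using eigen bij_betwE[OF e] by blast
  then obtain l where "\<And>j. T *v e j = l j *\<^sub>R e j" by metis
  then have "T = c_diag e (\<chi> j. l j)"
    by (intro c_onb_matrix_eq[OF onb]) (simp add: c_onb_diag_mult_basis[OF onb] scaleR_eq_of_real_scale)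
  with onb that show ?thesis by blast
qed

lemma c_injective_iff_span_squared_coordinates:
  fixes x :: "nat \<Rightarrow> complex ^ 'n"
  shows "c_injective x m \<longleftrightarrow>
     (\<forall>e. c_onb e \<longrightarrow> span ((\<lambda>k. \<chi> j. (cmod (c_inner (x k) (e j)))\<^sup>2) ` {1..m}) = UNIV)"
proof (intro iffI allI impI)
  fix e :: "'n \<Rightarrow> complex ^ 'n" assume inj: "c_injective x m" and "c_onb e"
  show "span ((\<lambda>k. \<chi> j. (cmod (c_inner (x k) (e j)))\<^sup>2) ` {1..m}) = UNIV"
    unfolding span_eq_UNIV_iff_perp_zero
  proof (intro allI impI)
    fix d assume "\<forall>y\<in>(\<lambda>k. \<chi> j. (cmod (c_inner (x k) (e j)))\<^sup>2) ` {1..m}. d \<bullet> y = 0"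
    then have "\<forall>k\<in>{1..m}. c_inner (c_diag e d *v x k) (x k) = 0"
      by (simp add: c_diag_quadratic_form)
    then have "c_diag e d = 0"
      using inj c_self_adjoint_diag unfolding c_injective_def by blast
    then show "d = 0" using c_onb_diag_eq_0_iff[OF \<open>c_onb e\<close>] by blast
  qed
next
  assume span: "\<forall>e. c_onb e \<longrightarrow> span ((\<lambda>k. \<chi> j. (cmod (c_inner (x k) (e j)))\<^sup>2) ` {1..m}) = UNIV"
  show "c_injective x m"
    unfolding c_injective_def
  proof (intro allI impI)
    fix T assume "c_self_adjoint T" and zero: "\<forall>k\<in>{1..m}. c_inner (T *v x k) (x k) = 0"
    from \<open>c_self_adjoint T\<close> obtain e d where "c_onb e" and T: "T = c_diag e d"
      by (rule c_self_adjoint_diagonalizable)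
    have "\<forall>y\<in>(\<lambda>k. \<chi> j. (cmod (c_inner (x k) (e j)))\<^sup>2) ` {1..m}. d \<bullet> y = 0"
      using zero by (simp add: T c_diag_quadratic_form)
    then have "d = 0"
      using span \<open>c_onb e\<close> unfolding span_eq_UNIV_iff_perp_zero by blast
    then show "T = 0" using c_onb_diag_eq_0_iff[OF \<open>c_onb e\<close>] T by blast
  qed
qed

theorem mainTheorem3:
  shows "(\<forall>(x :: nat \<Rightarrow> real ^ 'n) m. r_frame x m \<longrightarrow>
            (r_injective x m \<longleftrightarrow>
              (\<forall>e. r_onb e \<longrightarrow>
                 span ((\<lambda>k. \<chi> j. (x k \<bullet> e j)\<^sup>2) ` {1..m}) = (UNIV :: (real ^ 'n) set))))
       \<and> (\<forall>(x :: nat \<Rightarrow> complex ^ 'n) m. c_frame x m \<longrightarrow>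
            (c_injective x m \<longleftrightarrow>
              (\<forall>e. c_onb e \<longrightarrow>
                 span ((\<lambda>k. \<chi> j. (cmod (c_inner (x k) (e j)))\<^sup>2) ` {1..m})
                   = (UNIV :: (real ^ 'n) set))))"
  using r_injective_iff_span_squared_coordinates c_injective_iff_span_squared_coordinates
  by blast

end
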